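(* Let $G=\mathbb{C}\ltimes_{\rho}\mathbb{C}^2$, $\rho(z)=\mathrm{diag}(e^z,e^{-z})$, be the simply connected complex solvable Lie group and let $\mathfrak{g}=\mathbb{C}\ltimes_{d\rho}\mathbb{C}^2$ be its Lie algebra. Take the $\mathbb{R}$-basis of $\mathfrak{g}$ $$T=(1,0,0),\quad X=(0,1,0),\quad Y=(0,0,1),\quad T'=(\mathrm{i},0,0),\quad X'=(0,\mathrm{i},0),\quad Y'=(0,0,\mathrm{i}).$$ Regard $\mathfrak{g}$ as a $6$-dimensional real Lie algebra, and let $J$ be the complex structure on $\mathfrak{g}$ determined by the complex Lie subalgebra $\mathfrak{g}^{1,0}\subset\mathfrak{g}_{\mathbb{C}}=\mathfrak{g}\otimes_{\mathbb{R}}\mathbb{C}$ given by $$\mathfrak{g}^{1,0}=\mathrm{Span}_{\mathbb{C}}\{\,T-\mathrm{i}T',\; X-\mathrm{i}X'+2\mathrm{i}(X'+T'),\; Y-\mathrm{i}Y'\,\}.$$ Then the complex manifold $G$ endowed with the left-invariant complex structure induced by $J$ is not Stein.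
   Context: The group $G$ is $\mathbb{C}\times\mathbb{C}^2$ with coordinates $(t,x,y)$ and multiplication $(t,x,y)\cdot(t',x',y')=(t+t',\,x+e^{t}x',\,y+e^{-t}y')$. Its Lie algebra $\mathfrak{g}$ is the $3$-dimensional complex Lie algebra with $\mathbb{C}$-basis $T,X,Y$ and brackets $[T,X]=X$, $[T,Y]=-Y$, $[X,Y]=0$; the vectors $T',X',Y'$ are the multiples of $T,X,Y$ by $\mathrm{i}$ for the complex structure of $\mathfrak{g}$ as a complex Lie algebra. Here $\mathfrak{g}$ is viewed as a real Lie algebra and $\mathfrak{g}_{\mathbb{C}}=\mathfrak{g}\otimes_{\mathbb{R}}\mathbb{C}$ is its complexification; the scalar $\mathrm{i}$ appearing in the definition of $\mathfrak{g}^{1,0}$ is the scalar of the factor $\mathbb{C}$ in $\mathfrak{g}\otimes_{\mathbb{R}}\mathbb{C}$ (so $T-\mathrm{i}T'$ means $T\otimes 1-T'\otimes\mathrm{i}$). The complex structure determined by $\mathfrak{g}^{1,0}$ is the $\mathbb{R}$-linear map $J:\mathfrak{g}\to\mathfrak{g}$ with $J^2=-\mathrm{id}$ whose $\mathbb{C}$-linear extension to $\mathfrak{g}_{\mathbb{C}}$ has $\mathfrak{g}^{1,0}$ as $\mathrm{i}$-eigenspace and the complex conjugate $\mathfrak{g}^{0,1}=\overline{\mathfrak{g}^{1,0}}$ as $(-\mathrm{i})$-eigenspace. The induced left-invariant complex structure on the real Lie group $G$ is obtained by transporting $J$ on $T_eG=\mathfrak{g}$ to every tangent space by left translations. *)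

theory Defs
  imports "HOL-Analysis.Analysis"
begin

section \<open>Complex manifolds and Stein manifolds\<close>

definition holomorphic_on_Cn :: "(complex^'n::finite) set \<Rightarrow> (complex^'n \<Rightarrow> complex) \<Rightarrow> bool" where
  "holomorphic_on_Cn S f \<longleftrightarrow>
     (\<forall>z\<in>S. \<exists>D. (f has_derivative D) (at z) \<and> (\<forall>c v. D (c *s v) = c * D v))"

text \<open>A chart is a pair of a domain and a map; only the values of the map on the domain matter.
  The class constraints provide the Hausdorff and second countability axioms.\<close>

type_synonym ('a, 'n) cchart = "'a set \<times> ('a \<Rightarrow> complex^'n)"

definition complex_atlas ::
  "('a::{t2_space, second_countable_topology}, 'n::finite) cchart set \<Rightarrow> bool" where
  "complex_atlas A \<longleftrightarrow>
     (\<forall>p. \<exists>(U, \<phi>)\<in>A. p \<in> U) \<and>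
     (\<forall>(U, \<phi>)\<in>A. open U \<and> open (\<phi> ` U) \<and> homeomorphism U (\<phi> ` U) \<phi> (inv_into U \<phi>)) \<and>
     (\<forall>(U, \<phi>)\<in>A. \<forall>(V, \<psi>)\<in>A. \<forall>i.
        holomorphic_on_Cn (\<phi> ` (U \<inter> V)) (\<lambda>z. \<psi> (inv_into U \<phi> z) $ i))"

definition holomorphic_functions :: "('a, 'n::finite) cchart set \<Rightarrow> ('a \<Rightarrow> complex) set" where
  "holomorphic_functions A =
     {f. \<forall>(U, \<phi>)\<in>A. holomorphic_on_Cn (\<phi> ` U) (\<lambda>z. f (inv_into U \<phi> z))}"

definition holomorphic_hull :: "('a, 'n::finite) cchart set \<Rightarrow> 'a set \<Rightarrow> 'a set" where
  "holomorphic_hull A K =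
     {p. \<forall>f\<in>holomorphic_functions A. cmod (f p) \<le> (SUP q\<in>K. cmod (f q))}"

definition holomorphically_convex :: "('a::topological_space, 'n::finite) cchart set \<Rightarrow> bool" where
  "holomorphically_convex A \<longleftrightarrow>
     (\<forall>K. compact K \<and> K \<noteq> {} \<longrightarrow> compact (holomorphic_hull A K))"

definition holomorphically_separable :: "('a, 'n::finite) cchart set \<Rightarrow> bool" where
  "holomorphically_separable A \<longleftrightarrow>
     (\<forall>p q. p \<noteq> q \<longrightarrow> (\<exists>f\<in>holomorphic_functions A. f p \<noteq> f q))"

definition stein :: "('a::{t2_space, second_countable_topology}, 'n::finite) cchart set \<Rightarrow> bool" where
  "stein A \<longleftrightarrow>
     complex_atlas A \<and> holomorphically_convex A \<and> holomorphically_separable A"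


section \<open>The complex atlas of an almost complex structure\<close>

text \<open>On a manifold that is globally a real vector space every tangent space is that vector space,
  and an almost complex structure is a field \<open>p \<mapsto> I p\<close> of real endomorphisms.
  The holomorphic charts are the diffeomorphisms \<open>\<phi>\<close> of open sets onto open subsets of complex
  coordinate space with \<open>d\<phi> \<circ> I = \<i> d\<phi>\<close>; for smooth \<open>I\<close> they cover the manifold iff \<open>I\<close> is integrable.\<close>

definition holomorphic_charts ::
  "('a::real_normed_vector \<Rightarrow> 'a \<Rightarrow> 'a) \<Rightarrow> ('a, 'n::finite) cchart set" where
  "holomorphic_charts I =
     {(U, \<phi>). open U \<and> open (\<phi> ` U) \<and> inj_on \<phi> U \<and>
        (\<forall>p\<in>U. \<exists>D. (\<phi> has_derivative D) (at p) \<and> (\<forall>v. D (I p v) = \<i> *s D v)) \<and>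
        (\<forall>z\<in>\<phi> ` U. inv_into U \<phi> differentiable (at z))}"


section \<open>Complexification of a real vector space\<close>

text \<open>The pair \<open>(u, v)\<close> stands for \<open>u \<otimes> 1 + v \<otimes> \<i>\<close>.\<close>

definition ctensor :: "'a::real_vector \<Rightarrow> complex \<Rightarrow> 'a \<times> 'a" (infixl "\<otimes>" 75) where
  "u \<otimes> z = (Re z *\<^sub>R u, Im z *\<^sub>R u)"

definition cscale :: "complex \<Rightarrow> 'a::real_vector \<times> 'a \<Rightarrow> 'a \<times> 'a" (infixr "\<odot>" 75) where
  "z \<odot> w = (Re z *\<^sub>R fst w - Im z *\<^sub>R snd w, Re z *\<^sub>R snd w + Im z *\<^sub>R fst w)"

definition cconj :: "'a::real_vector \<times> 'a \<Rightarrow> 'a \<times> 'a" where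
  "cconj w = (fst w, - snd w)"

definition cextend :: "('a::real_vector \<Rightarrow> 'a) \<Rightarrow> 'a \<times> 'a \<Rightarrow> 'a \<times> 'a" where
  "cextend J w = (J (fst w), J (snd w))"

interpretation cpx: vector_space cscale
  by unfold_locales (auto simp: cscale_def algebra_simps)

lemma cscale_ctensor: "z \<odot> (u \<otimes> w) = u \<otimes> (z * w)"
  by (simp add: cscale_def ctensor_def algebra_simps)

lemma ctensor_decompose: "w = fst w \<otimes> 1 + snd w \<otimes> \<i>"
  by (simp add: ctensor_def)

definition complex_structure_determined_by ::
  "('a::real_vector \<Rightarrow> 'a) \<Rightarrow> ('a \<times> 'a) set \<Rightarrow> bool" where
  "complex_structure_determined_by J V \<longleftrightarrow>
     linear J \<and> (\<forall>v. J (J v) = - v) \<and>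
     {w. cextend J w = \<i> \<odot> w} = V \<and>
     {w. cextend J w = (- \<i>) \<odot> w} = cconj ` V"


section \<open>The group and its Lie algebra\<close>

text \<open>Elements of the Lie algebra are identified with tangent vectors at the unit element
  \<open>(0, 0, 0)\<close> through the coordinates, so both live on the same type.\<close>

type_synonym G = "complex \<times> complex \<times> complex"
type_synonym \<gg> = "complex \<times> complex \<times> complex"

fun gmult :: "G \<Rightarrow> G \<Rightarrow> G" where
  "gmult (t, x, y) (t', x', y') = (t + t', x + exp t * x', y + exp (- t) * y')"

fun lie_bracket :: "\<gg> \<Rightarrow> \<gg> \<Rightarrow> \<gg>" where
  "lie_bracket (a, b, c) (a', b', c') = (0, a * b' - a' * b, - (a * c' - a' * c))"

definition lie_bracket_C :: "\<gg> \<times> \<gg> \<Rightarrow> \<gg> \<times> \<gg> \<Rightarrow> \<gg> \<times> \<gg>" where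
  "lie_bracket_C w w' =
     (lie_bracket (fst w) (fst w') - lie_bracket (snd w) (snd w'),
      lie_bracket (fst w) (snd w') + lie_bracket (snd w) (fst w'))"

definition T :: \<gg> where "T = (1, 0, 0)"
definition X :: \<gg> where "X = (0, 1, 0)"
definition Y :: \<gg> where "Y = (0, 0, 1)"
definition T' :: \<gg> where "T' = (\<i>, 0, 0)"
definition X' :: \<gg> where "X' = (0, \<i>, 0)"
definition Y' :: \<gg> where "Y' = (0, 0, \<i>)"

definition g10 :: "(\<gg> \<times> \<gg>) set" where
  "g10 = cpx.span
     {T \<otimes> 1 - T' \<otimes> \<i>,
      X \<otimes> 1 - X' \<otimes> \<i> + (X' + T') \<otimes> (2 * \<i>),
      Y \<otimes> 1 - Y' \<otimes> \<i>}"

text \<open>The differential at the unit element of left translation by \<open>p\<close>.\<close>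

definition left_transport :: "G \<Rightarrow> \<gg> \<Rightarrow> G" where
  "left_transport p = frechet_derivative (gmult p) (at (0, 0, 0))"

definition left_invariant :: "(\<gg> \<Rightarrow> \<gg>) \<Rightarrow> G \<Rightarrow> G \<Rightarrow> G" where
  "left_invariant J p v = left_transport p (J (inv (left_transport p) v))"

definition G_atlas :: "(\<gg> \<Rightarrow> \<gg>) \<Rightarrow> (G, 3) cchart set" where
  "G_atlas J = holomorphic_charts (left_invariant J)"


section \<open>The objects above are well defined\<close>

lemma bracket_basis: "lie_bracket T X = X" "lie_bracket T Y = - Y" "lie_bracket X Y = 0"
  by (simp_all add: T_def X_def Y_def zero_prod_def)

lemma g10_iff:
  "w \<in> g10 \<longleftrightarrow> (\<exists>\<alpha> \<beta> \<gamma>. w = ((\<alpha> - 2 * \<i> * of_real (Im \<beta>), cnj \<beta>, \<gamma>),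
      (- \<i> * \<alpha> + 2 * \<i> * of_real (Re \<beta>), \<i> * cnj \<beta>, - \<i> * \<gamma>)))"
proof -
  have "w \<in> g10 \<longleftrightarrow> (\<exists>\<alpha> \<beta> \<gamma>. w = \<alpha> \<odot> (T \<otimes> 1 - T' \<otimes> \<i>) +
      \<beta> \<odot> (X \<otimes> 1 - X' \<otimes> \<i> + (X' + T') \<otimes> (2 * \<i>)) + \<gamma> \<odot> (Y \<otimes> 1 - Y' \<otimes> \<i>))"
    unfolding g10_def cpx.span_insert cpx.span_empty
    by (auto simp: algebra_simps)
  moreover have "\<alpha> \<odot> (T \<otimes> 1 - T' \<otimes> \<i>) +
      \<beta> \<odot> (X \<otimes> 1 - X' \<otimes> \<i> + (X' + T') \<otimes> (2 * \<i>)) + \<gamma> \<odot> (Y \<otimes> 1 - Y' \<otimes> \<i>) =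
      ((\<alpha> - 2 * \<i> * of_real (Im \<beta>), cnj \<beta>, \<gamma>),
      (- \<i> * \<alpha> + 2 * \<i> * of_real (Re \<beta>), \<i> * cnj \<beta>, - \<i> * \<gamma>))" for \<alpha> \<beta> \<gamma>
    by (simp add: cscale_def ctensor_def T_def X_def Y_def T'_def X'_def Y'_def complex_eq_iff)
  ultimately show ?thesis by simp
qed

lemma g10_subalgebra:
  assumes "w \<in> g10" "w' \<in> g10"
  shows "lie_bracket_C w w' \<in> g10"
proof -
  obtain \<alpha> \<beta> \<gamma> where w: "w = ((\<alpha> - 2 * \<i> * of_real (Im \<beta>), cnj \<beta>, \<gamma>),
      (- \<i> * \<alpha> + 2 * \<i> * of_real (Re \<beta>), \<i> * cnj \<beta>, - \<i> * \<gamma>))"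
    using assms(1) g10_iff by blast
  obtain \<alpha>' \<beta>' \<gamma>' where w': "w' = ((\<alpha>' - 2 * \<i> * of_real (Im \<beta>'), cnj \<beta>', \<gamma>'),
      (- \<i> * \<alpha>' + 2 * \<i> * of_real (Re \<beta>'), \<i> * cnj \<beta>', - \<i> * \<gamma>'))"
    using assms(2) g10_iff by blast
  show ?thesis
    unfolding g10_iff
    by (rule exI[of _ 0], rule exI[of _ 0],
        rule exI[of _ "- 2 * (\<alpha> - \<beta>) * \<gamma>' + 2 * (\<alpha>' - \<beta>') * \<gamma>"])
       (simp add: w w' lie_bracket_C_def complex_eq_iff algebra_simps)
qed

lemma complex_structure_iff:
  "complex_structure_determined_by J g10 \<longleftrightarrow>
     J = (\<lambda>(a, b, c). (\<i> * a - 2 * \<i> * b, - \<i> * b, \<i> * c))"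
proof
  assume J: "complex_structure_determined_by J g10"
  show "J = (\<lambda>(a, b, c). (\<i> * a - 2 * \<i> * b, - \<i> * b, \<i> * c))"
  proof
    fix u :: \<gg>
    obtain a b c where u: "u = (a, b, c)" by (cases u)
    have "((a, b, c), (- \<i> * a + 2 * \<i> * b, \<i> * b, - \<i> * c)) \<in> g10"
      unfolding g10_iff
      by (rule exI[of _ "a - 2 * \<i> * of_real (Im b)"], rule exI[of _ "cnj b"], rule exI[of _ c])
         (simp add: complex_eq_iff)
    then have "cextend J ((a, b, c), (- \<i> * a + 2 * \<i> * b, \<i> * b, - \<i> * c)) =
        \<i> \<odot> ((a, b, c), (- \<i> * a + 2 * \<i> * b, \<i> * b, - \<i> * c))"
      using J by (auto simp: complex_structure_determined_by_def)
    then show "J u = (\<lambda>(a, b, c). (\<i> * a - 2 * \<i> * b, - \<i> * b, \<i> * c)) u"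
      by (simp add: u cextend_def cscale_def)
  qed
next
  assume J: "J = (\<lambda>(a, b, c). (\<i> * a - 2 * \<i> * b, - \<i> * b, \<i> * c))"
  have ex: "w \<in> g10 \<longleftrightarrow> snd w = - J (fst w)" for w
  proof
    assume "w \<in> g10"
    then show "snd w = - J (fst w)"
      unfolding g10_iff by (auto simp: J complex_eq_iff)
  next
    assume *: "snd w = - J (fst w)"
    obtain a b c where u: "fst w = (a, b, c)" by (cases "fst w")
    show "w \<in> g10"
      unfolding g10_iff
      by (rule exI[of _ "a - 2 * \<i> * of_real (Im b)"], rule exI[of _ "cnj b"], rule exI[of _ c])
         (use * u in \<open>auto simp: complex_eq_iff J prod_eq_iff\<close>)
  qed
  have JJ: "J (J v) = - v" for v
    by (cases v) (simp add: J algebra_simps)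
  have lin: "linear J"
    by (rule linearI) (auto simp: J algebra_simps scaleR_conv_of_real)
  have neg: "J (- v) = - J v" for v
    using lin by (simp add: linear_neg)
  have e1: "cextend J w = \<i> \<odot> w \<longleftrightarrow> snd w = - J (fst w)" for w
    by (auto simp: cextend_def cscale_def prod_eq_iff[of "(_, _)"] neg JJ)
  have e2: "cextend J w = (- \<i>) \<odot> w \<longleftrightarrow> snd w = J (fst w)" for w
    by (auto simp: cextend_def cscale_def prod_eq_iff[of "(_, _)"] neg JJ)
  have "w \<in> cconj ` g10 \<longleftrightarrow> snd w = J (fst w)" for w
  proof -
    have "w \<in> cconj ` g10 \<longleftrightarrow> cconj w \<in> g10"
      by (force simp: cconj_def image_iff intro!: bexI[of _ "cconj w"])
    then show ?thesis by (simp add: ex cconj_def)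
  qed
  then show "complex_structure_determined_by J g10"
    unfolding complex_structure_determined_by_def
    using lin JJ e1 e2 ex by blast
qed

lemma ex1_complex_structure: "\<exists>!J. complex_structure_determined_by J g10"
  by (simp add: complex_structure_iff)

lemma left_transport_eq: "left_transport (t, x, y) = (\<lambda>(a, b, c). (a, exp t * b, exp (- t) * c))"
proof -
  have "gmult (t, x, y) = (\<lambda>q. (t + fst q, x + exp t * fst (snd q), y + exp (- t) * snd (snd q)))"
    by auto
  moreover have "((\<lambda>q. (t + fst q, x + exp t * fst (snd q), y + exp (- t) * snd (snd q)))
      has_derivative (\<lambda>q. (fst q, exp t * fst (snd q), exp (- t) * snd (snd q)))) (at (0, 0, 0))"
    by (auto intro!: derivative_eq_intros)
  ultimately show ?thesis
    unfolding left_transport_def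
    by (metis (no_types, lifting) frechet_derivative_at ext case_prod_beta)
qed

lemma left_invariant_eq:
  assumes "complex_structure_determined_by J g10"
  shows "left_invariant J (t, x, y) (a, b, c) =
    (\<i> * a - 2 * \<i> * exp (- t) * b, - \<i> * b, \<i> * c)"
proof -
  have "inv (left_transport (t, x, y)) (a, b, c) = (a, exp (- t) * b, exp t * c)"
    by (rule inv_f_eq)
       (auto simp: left_transport_eq inj_on_def mult.assoc[symmetric] simp flip: exp_add)
  then show ?thesis
    using assms
    by (simp add: left_invariant_def left_transport_eq complex_structure_iff
        mult.assoc[symmetric] mult.commute[of "exp _" \<i>] mult.commute[of "- exp _" \<i>] exp_minus)
qed

text \<open>Integrability: around every point the functions \<open>x - e^t\<close>, \<open>cnj x\<close> and \<open>y\<close> form a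
  holomorphic chart.\<close>

lemma local_chart:
  assumes J: "complex_structure_determined_by J g10"
  shows "\<exists>(U, \<phi>)\<in>G_atlas J. p \<in> U"
proof -
  obtain t0 x0 y0 where p: "p = (t0, x0, y0)" by (cases p)
  define U :: "G set" where "U = {q. \<bar>Im (fst q - t0)\<bar> < pi}"
  define \<phi> :: "G \<Rightarrow> complex^3" where
    "\<phi> = (\<lambda>q. \<chi> i. if i = 1 then fst (snd q) - exp (fst q) else
                    if i = 2 then cnj (fst (snd q)) else snd (snd q))"
  define W :: "(complex^3) set" where
    "W = {w. (cnj (w $ 2) - w $ 1) / exp t0 \<notin> \<real>\<^sub>\<le>\<^sub>0}"
  define g :: "complex^3 \<Rightarrow> G" where
    "g = (\<lambda>w. (t0 + Ln ((cnj (w $ 2) - w $ 1) / exp t0), cnj (w $ 2), w $ 3))"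
  have "W = (\<lambda>w. (cnj (w $ 2) - w $ 1) / exp t0) -` (- \<real>\<^sub>\<le>\<^sub>0)"
    by (auto simp: W_def)
  then have openW: "open W"
    by (auto intro!: continuous_open_vimage continuous_intros closed_nonpos_Reals_complex)
  have openU: "open U"
    unfolding U_def by (intro open_Collect_less continuous_intros)
  have *: "exp t / exp t0 \<notin> \<real>\<^sub>\<le>\<^sub>0 \<and> Ln (exp t / exp t0) = t - t0"
    if "\<bar>Im (t - t0)\<bar> < pi" for t
  proof -
    have L: "Ln (exp (t - t0)) = t - t0"
      by (rule Ln_exp) (use that in auto)
    moreover have "exp (t - t0) \<notin> \<real>\<^sub>\<le>\<^sub>0"
    proof
      assume a: "exp (t - t0) \<in> \<real>\<^sub>\<le>\<^sub>0"
      then have "Re (exp (t - t0)) < 0" "Im (exp (t - t0)) = 0"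
        by (auto simp: complex_nonpos_Reals_iff less_le complex_eq_iff)
           (metis complex_eq_iff exp_not_eq_zero zero_complex.sel)
      then have "Im (Ln (exp (t - t0))) = pi"
        by (subst Im_Ln_eq_pi) auto
      with that L show False by simp
    qed
    ultimately show ?thesis by (simp add: exp_diff)
  qed
  have gphi: "g (\<phi> q) = q" "\<phi> q \<in> W" if "q \<in> U" for q
    using that *[of "fst q"] by (auto simp: g_def \<phi>_def W_def U_def)
  have phig: "\<phi> (g w) = w" "g w \<in> U" if "w \<in> W" for w
  proof -
    let ?z = "(cnj (w $ 2) - w $ 1) / exp t0"
    have z: "?z \<notin> \<real>\<^sub>\<le>\<^sub>0" using that by (simp add: W_def)
    then have "?z \<noteq> 0" by auto
    then have "exp (t0 + Ln ?z) = cnj (w $ 2) - w $ 1"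
      by (simp add: exp_add)
    then show "\<phi> (g w) = w"
      by (simp add: g_def \<phi>_def vec_eq_iff forall_3)
    show "g w \<in> U"
      using z \<open>?z \<noteq> 0\<close> Im_Ln_eq_pi[of ?z] Im_Ln_le_pi[of ?z] mpi_less_Im_Ln[of ?z]
      by (auto simp: g_def U_def complex_nonpos_Reals_iff abs_less_iff less_le)
  qed
  have img: "\<phi> ` U = W"
    using gphi phig by (auto simp: image_iff) metis
  have inj: "inj_on \<phi> U"
    using gphi by (metis inj_onI)
  have inv: "inv_into U \<phi> w = g w" if "w \<in> W" for w
    using inj phig[OF that] by (metis inv_into_f_f)
  have d1: "\<exists>D. (\<phi> has_derivative D) (at q) \<and> (\<forall>v. D (left_invariant J q v) = \<i> *s D v)" for q
  proof -
    define D :: "G \<Rightarrow> complex^3" where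
      "D = (\<lambda>v. \<chi> i. if i = 1 then fst (snd v) - exp (fst q) * fst v else
                      if i = 2 then cnj (fst (snd v)) else snd (snd v))"
    have e: "((\<lambda>r::G. exp (fst r)) has_derivative (\<lambda>v. exp (fst q) * fst v)) (at q)"
      by (rule has_derivative_compose[OF has_derivative_fst[OF has_derivative_ident]
            has_field_derivative_imp_has_derivative[OF DERIV_exp]])
    have "((\<lambda>r. \<phi> r $ i) has_derivative (\<lambda>v. D v $ i)) (at q)" for i
      unfolding \<phi>_def D_def
      by (cases "i = 1"; cases "i = 2") (auto intro!: derivative_eq_intros e)
    then have "(\<phi> has_derivative D) (at q)"
      by (subst has_derivative_componentwise_within)
         (auto simp: Basis_vec_def inner_axis intro!: has_derivative_inner_left)
    moreover have "D (left_invariant J q v) = \<i> *s D v" for v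
    proof -
      obtain t x y a b c where "q = (t, x, y)" "v = (a, b, c)"
        by (metis prod_cases3)
      then show ?thesis
        by (simp add: left_invariant_eq[OF J] D_def vec_eq_iff algebra_simps exp_minus)
    qed
    ultimately show ?thesis by blast
  qed
  have d2: "inv_into U \<phi> differentiable (at w)" if w: "w \<in> W" for w
  proof -
    let ?z = "\<lambda>w. (cnj (w $ 2) - w $ 1) / exp t0"
    have nz: "?z w \<notin> \<real>\<^sub>\<le>\<^sub>0" using w by (simp add: W_def)
    have b: "((\<lambda>w. w $ i) has_derivative (\<lambda>w. w $ i)) (at w)" for i and w :: "complex^3"
      by (rule bounded_linear.has_derivative[OF bounded_linear_vec_nth]) auto
    have "(?z has_derivative (\<lambda>v. (cnj (v $ 2) - v $ 1) / exp t0)) (at w)"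
      by (auto intro!: derivative_eq_intros b)
    from has_derivative_compose[OF this has_field_derivative_imp_has_derivative
        [OF has_field_derivative_Ln[OF nz]]]
    have "(g has_derivative (\<lambda>v. (inverse (?z w) * ((cnj (v $ 2) - v $ 1) / exp t0),
        cnj (v $ 2), v $ 3))) (at w)"
      unfolding g_def by (auto intro!: derivative_eq_intros b)
    then have "(inv_into U \<phi> has_derivative (\<lambda>v. (inverse (?z w) * ((cnj (v $ 2) - v $ 1) / exp t0),
        cnj (v $ 2), v $ 3))) (at w)"
      by (rule has_derivative_transform_within_open[OF _ openW w]) (simp add: inv)
    then show ?thesis by (auto simp: differentiable_def)
  qed
  have "(U, \<phi>) \<in> G_atlas J"
    unfolding G_atlas_def holomorphic_charts_def mem_Collect_eq prod.case img
    using openU openW inj d1 d2 by blast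
  moreover have "p \<in> U" by (simp add: p U_def)
  ultimately show ?thesis by auto
qed

lemma complex_linear_vec:
  fixes D :: "complex^'n \<Rightarrow> complex^'m"
  assumes "linear D" "\<And>v. D (\<i> *s v) = \<i> *s D v"
  shows "D (c *s v) = c *s D v"
proof -
  have eq: "c *s w = Re c *\<^sub>R w + Im c *\<^sub>R (\<i> *s w)" for w :: "complex^'k"
    by (simp add: vec_eq_iff complex_eq_iff)
  show ?thesis
    unfolding eq by (simp add: assms linear_add linear_scale)
qed

lemma transition_holomorphic:
  fixes I :: "'a::real_normed_vector \<Rightarrow> 'a \<Rightarrow> 'a"
  assumes 1: "(U, \<phi>) \<in> holomorphic_charts I" and 2: "(V, \<psi>) \<in> holomorphic_charts I"
  shows "holomorphic_on_Cn (\<phi> ` (U \<inter> V)) (\<lambda>z. \<psi> (inv_into U \<phi> z) $ i)"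
  unfolding holomorphic_on_Cn_def
proof
  fix z assume "z \<in> \<phi> ` (U \<inter> V)"
  then obtain p where p: "p \<in> U" "p \<in> V" "z = \<phi> p" by auto
  have inj: "inj_on \<phi> U" and oU: "open U" and oW: "open (\<phi> ` U)"
    using 1 by (auto simp: holomorphic_charts_def)
  have inv: "inv_into U \<phi> z = p" using p inj by simp
  obtain D where D: "(\<phi> has_derivative D) (at p)" "\<And>v. D (I p v) = \<i> *s D v"
    using 1 p by (fastforce simp: holomorphic_charts_def)
  obtain D' where D': "(\<psi> has_derivative D') (at p)" "\<And>v. D' (I p v) = \<i> *s D' v"
    using 2 p by (fastforce simp: holomorphic_charts_def)
  have "inv_into U \<phi> differentiable (at z)"
    using 1 p by (auto simp: holomorphic_charts_def)
  then obtain E where E: "(inv_into U \<phi> has_derivative E) (at z)"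
    by (auto simp: differentiable_def)
  have "((\<lambda>w. \<phi> (inv_into U \<phi> w)) has_derivative (\<lambda>v. D (E v))) (at z)"
    using has_derivative_compose[OF E] D inv by simp
  moreover have "((\<lambda>w. \<phi> (inv_into U \<phi> w)) has_derivative (\<lambda>v. v)) (at z)"
    by (rule has_derivative_transform_within_open[OF has_derivative_ident oW])
       (use p in \<open>auto simp: f_inv_into_f\<close>)
  ultimately have DE: "D (E v) = v" for v
    by (metis has_derivative_unique)
  have "((\<lambda>q. inv_into U \<phi> (\<phi> q)) has_derivative (\<lambda>v. E (D v))) (at p)"
    using has_derivative_compose[OF D(1)] E p by simp
  moreover have "((\<lambda>q. inv_into U \<phi> (\<phi> q)) has_derivative (\<lambda>v. v)) (at p)"
    by (rule has_derivative_transform_within_open[OF has_derivative_ident oU p(1)])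
       (use inj in simp)
  ultimately have ED: "E (D v) = v" for v
    by (metis has_derivative_unique)
  have Ei: "E (\<i> *s v) = I p (E v)" for v
    by (metis D(2) DE ED)
  have comp: "((\<lambda>w. \<psi> (inv_into U \<phi> w)) has_derivative (\<lambda>v. D' (E v))) (at z)"
    using has_derivative_compose[OF E] D' inv by simp
  have "D' (E (c *s v)) = c *s D' (E v)" for c v
    by (rule complex_linear_vec[of "\<lambda>v. D' (E v)"])
       (use comp has_derivative_linear in \<open>auto simp: Ei D'(2)\<close>)
  moreover have "((\<lambda>w. \<psi> (inv_into U \<phi> w) $ i) has_derivative (\<lambda>v. D' (E v) $ i)) (at z)"
    by (rule bounded_linear.has_derivative[OF bounded_linear_vec_nth comp])
  ultimately show "\<exists>D. ((\<lambda>z. \<psi> (inv_into U \<phi> z) $ i) has_derivative D) (at z) \<and>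
      (\<forall>c v. D (c *s v) = c * D v)"
    by (intro exI[of _ "\<lambda>v. D' (E v) $ i"]) simp
qed

theorem G_complex_manifold:
  assumes "complex_structure_determined_by J g10"
  shows "complex_atlas (G_atlas J)"
  unfolding complex_atlas_def
proof (intro conjI)
  show "\<forall>p. \<exists>(U, \<phi>)\<in>G_atlas J. p \<in> U"
    using local_chart[OF assms] by blast
  have "homeomorphism U (\<phi> ` U) \<phi> (inv_into U \<phi>)" if "(U, \<phi>) \<in> G_atlas J" for U \<phi>
  proof -
    have "continuous_on U \<phi>"
      using that
      by (fastforce simp: G_atlas_def holomorphic_charts_def
          intro: continuous_at_imp_continuous_on has_derivative_continuous)
    moreover have "continuous_on (\<phi> ` U) (inv_into U \<phi>)"
      using that
      by (auto simp: G_atlas_def holomorphic_charts_def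
          intro!: continuous_at_imp_continuous_on differentiable_imp_continuous_within)
    moreover have "inj_on \<phi> U"
      using that by (auto simp: G_atlas_def holomorphic_charts_def)
    ultimately show ?thesis
      by (auto simp: homeomorphism_def image_iff)
  qed
  then show "\<forall>(U, \<phi>)\<in>G_atlas J. open U \<and> open (\<phi> ` U) \<and> homeomorphism U (\<phi> ` U) \<phi> (inv_into U \<phi>)"
    by (auto simp: G_atlas_def holomorphic_charts_def)
  show "\<forall>(U, \<phi>)\<in>G_atlas J. \<forall>(V, \<psi>)\<in>G_atlas J. \<forall>i.
        holomorphic_on_Cn (\<phi> ` (U \<inter> V)) (\<lambda>z. \<psi> (inv_into U \<phi> z) $ i)"
    using transition_holomorphic unfolding G_atlas_def by blast
qed

end

theory Submission
  imports Defs "HOL-Complex_Analysis.Complex_Analysis"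
begin

text \<open>
  The functions \<open>u = x - e\<^sup>t\<close>, \<open>v = cnj x\<close> and \<open>y\<close> are holomorphic, and
  \<open>cnj v - u = e\<^sup>t\<close> never vanishes. Hence \<open>G\<close> is \<open>\<complex>\<close> times the universal covering of the complement
  of the totally real plane \<open>{u = cnj v}\<close> in \<open>\<complex>\<^sup>2\<close>, and a deck transformation adds \<open>2 \<pi> \<i>\<close>
  to \<open>t\<close>. A function that is holomorphic off a totally real plane extends across it, because analytic
  discs in the complement can be pushed until they touch the plane (the continuity principle). As the
  extension is single valued, a holomorphic function on \<open>G\<close> cannot tell the sheets of the covering
  apart, so \<open>G\<close> is not holomorphically separable.

  Concretely, write \<open>u = z - q\<close> and \<open>v = z + q\<close>. The totally real plane becomes
  \<open>{Im z = 0 \<and> Re q = 0}\<close>, and the principal logarithm gives a section of the covering over the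
  complement of the slit \<open>Im z = 0 \<and> Re q \<le> 0\<close>. The analytic discs are
  \<open>q = z\<^sup>2 + s\<close> with \<open>\<bar>z\<bar> \<le> 1\<close>; they avoid the slit when \<open>Re s > 0\<close>, and their boundary circles
  still avoid it when \<open>Re s > -1\<close>. The Cauchy integral over the boundary circles therefore defines one
  function \<open>Q(z, s)\<close> for \<open>\<bar>z\<bar> < 1\<close> and \<open>\<bar>Re s\<bar> < 1\<close>. For each fixed imaginary \<open>z \<noteq> 0\<close>
  the line \<open>q = z\<^sup>2 + s\<close> avoids the slit for all \<open>s\<close>, so there \<open>Q\<close> agrees with
  the given function for \<open>\<bar>Re s\<bar> < 1\<close> by the identity theorem
  (\<open>holomorphic_functions_eq_disc_integral\<close>). At \<open>s = -1/2\<close>, letting \<open>z\<close> tend to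
  \<open>0\<close> from either side of the slit yields the values of the given function at two points whose
  \<open>t\<close>-coordinates are \<open>\<i> \<pi>\<close> and \<open>-\<i> \<pi>\<close>, while \<open>Q(z, -1/2)\<close> has only one limit
  (\<open>holomorphic_functions_same_value\<close>).
\<close>

section \<open>Holomorphic dependence of contour integrals on a parameter\<close>

lemma continuous_on_contour_integral_parameter:
  fixes k :: "complex \<Rightarrow> complex \<Rightarrow> complex"
  assumes k: "continuous_on (path_image \<gamma> \<times> A) (\<lambda>(\<zeta>, s). k \<zeta> s)"
    and \<gamma>: "valid_path \<gamma>" "continuous_on {0..1} (\<lambda>t. vector_derivative \<gamma> (at t))"
  shows "continuous_on A (\<lambda>s. contour_integral \<gamma> (\<lambda>\<zeta>. k \<zeta> s))"
proof -
  have [continuous_intros]: "continuous_on {0..1} \<gamma>"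
    using \<gamma>(1) valid_path_imp_path path_def by blast
  have "continuous_on (A \<times> {0..1}) (\<lambda>p. k (\<gamma> (snd p)) (fst p))"
    by (rule continuous_on_compose2[OF k, of _ "\<lambda>p. (\<gamma> (snd p), fst p)", simplified])
       (auto intro!: continuous_intros continuous_on_compose2[of "{0..1}" \<gamma>] simp: path_image_def)
  moreover have "continuous_on (A \<times> {0..1}) (\<lambda>p. vector_derivative \<gamma> (at (snd p)))"
    by (rule continuous_on_compose2[OF \<gamma>(2)]) (auto intro!: continuous_intros)
  ultimately have "continuous_on (A \<times> cbox 0 1)
      (\<lambda>(s, t). k (\<gamma> t) s * vector_derivative \<gamma> (at t))"
    by (auto simp: case_prod_beta intro!: continuous_intros)
  from integral_continuous_on_param[OF this] show ?thesis
    by (simp add: contour_integral_integral)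
qed

text \<open>By Morera's theorem: the order of integration over a triangle and over the given contour can
  be exchanged, and the inner integrals over triangles vanish.\<close>

lemma holomorphic_on_contour_integral_parameter:
  fixes k :: "complex \<Rightarrow> complex \<Rightarrow> complex"
  assumes k: "continuous_on (path_image \<gamma> \<times> A) (\<lambda>(\<zeta>, s). k \<zeta> s)"
    and hol: "\<And>\<zeta>. \<zeta> \<in> path_image \<gamma> \<Longrightarrow> k \<zeta> holomorphic_on A"
    and A: "open A"
    and \<gamma>: "valid_path \<gamma>" "continuous_on {0..1} (\<lambda>t. vector_derivative \<gamma> (at t))"
  shows "(\<lambda>s. contour_integral \<gamma> (\<lambda>\<zeta>. k \<zeta> s)) holomorphic_on A"
proof -
  let ?F = "\<lambda>s. contour_integral \<gamma> (\<lambda>\<zeta>. k \<zeta> s)"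
  have "?F analytic_on A"
  proof (rule Morera_triangle[OF continuous_on_contour_integral_parameter[OF k \<gamma>] A], rule impI)
    fix a b c assume tri: "convex hull {a, b, c} \<subseteq> A"
    let ?l = "\<lambda>p q \<zeta>. contour_integral (linepath p q) (k \<zeta>)"
    have seg: "closed_segment a b \<subseteq> A" "closed_segment b c \<subseteq> A" "closed_segment c a \<subseteq> A"
      using tri by (simp_all add: segment_convex_hull)
        (meson hull_mono insertCI insert_subsetI empty_subsetI order_trans subset_iff)+
    have swap: "contour_integral (linepath p q) ?F = contour_integral \<gamma> (?l p q)"
      and int: "?l p q contour_integrable_on \<gamma>"
      if pq: "closed_segment p q \<subseteq> A" for p q
    proof -
      have kpq: "continuous_on (path_image \<gamma> \<times> path_image (linepath p q)) (\<lambda>(\<zeta>, s). k \<zeta> s)"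
        by (rule continuous_on_subset[OF k]) (use pq in auto)
      show "contour_integral (linepath p q) ?F = contour_integral \<gamma> (?l p q)"
        by (rule contour_integral_swap[symmetric, OF kpq \<gamma>(1) _ \<gamma>(2)]) auto
      have "continuous_on (path_image (linepath p q) \<times> path_image \<gamma>) (\<lambda>(s, \<zeta>). k \<zeta> s)"
        unfolding case_prod_beta
        by (rule continuous_on_compose2[OF kpq, of _ "\<lambda>p. (snd p, fst p)", simplified])
           (auto intro!: continuous_intros)
      then have "continuous_on (path_image \<gamma>) (?l p q)"
        by (intro continuous_on_contour_integral_parameter) auto
      then show "?l p q contour_integrable_on \<gamma>"
        unfolding contour_integrable_on
        by (intro integrable_continuous_real continuous_on_mult \<gamma>(2)
            continuous_on_compose2[of "path_image \<gamma>" "?l p q" _ \<gamma>])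
          (use valid_path_imp_path[OF \<gamma>(1)] in \<open>simp_all add: path_def path_image_def\<close>)
    qed
    have zero: "?l a b \<zeta> + ?l b c \<zeta> + ?l c a \<zeta> = 0" if "\<zeta> \<in> path_image \<gamma>" for \<zeta>
    proof -
      have h: "k \<zeta> holomorphic_on A" using hol that .
      have "k \<zeta> contour_integrable_on linepath p q" if "closed_segment p q \<subseteq> A" for p q
        by (rule contour_integrable_continuous_linepath)
           (use that h holomorphic_on_imp_continuous_on continuous_on_subset in blast)
      moreover have "(k \<zeta> has_contour_integral 0) (linepath a b +++ linepath b c +++ linepath c a)"
        by (rule Cauchy_theorem_triangle[OF holomorphic_on_subset[OF h tri]])
      ultimately show ?thesis
        using seg by (auto dest!: contour_integral_unique simp: add.assoc)
    qed
    have "contour_integral (linepath a b) ?F + contour_integral (linepath b c) ?F +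
        contour_integral (linepath c a) ?F
        = contour_integral \<gamma> (\<lambda>\<zeta>. ?l a b \<zeta> + ?l b c \<zeta> + ?l c a \<zeta>)"
      using seg by (simp add: swap int contour_integral_add contour_integrable_add)
    also have "\<dots> = contour_integral \<gamma> (\<lambda>\<zeta>. 0)"
      by (rule contour_integral_eq) (use zero in auto)
    finally show "contour_integral (linepath a b) ?F + contour_integral (linepath b c) ?F +
        contour_integral (linepath c a) ?F = 0" by simp
  qed
  then show ?thesis by (rule analytic_imp_holomorphic)
qed


section \<open>Holomorphic functions on the group\<close>

text \<open>Holomorphy in the charts amounts to the Cauchy--Riemann equation for the left-invariant
  almost complex structure.\<close>

lemma holomorphic_functions_has_derivative:
  assumes J: "complex_structure_determined_by J g10"
    and f: "f \<in> holomorphic_functions (G_atlas J)"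
  shows "\<exists>D. (f has_derivative D) (at p) \<and> (\<forall>v. D (left_invariant J p v) = \<i> * D v)"
proof -
  obtain U \<phi> where U: "(U, \<phi>) \<in> G_atlas J" "p \<in> U"
    using local_chart[OF J] by blast
  have oU: "open U" and inj: "inj_on \<phi> U"
    using U by (auto simp: G_atlas_def holomorphic_charts_def)
  obtain D where D: "(\<phi> has_derivative D) (at p)" "\<And>v. D (left_invariant J p v) = \<i> *s D v"
    using U by (fastforce simp: G_atlas_def holomorphic_charts_def)
  have "holomorphic_on_Cn (\<phi> ` U) (\<lambda>z. f (inv_into U \<phi> z))"
    using f U by (auto simp: holomorphic_functions_def)
  then obtain E where E: "((\<lambda>z. f (inv_into U \<phi> z)) has_derivative E) (at (\<phi> p))"
      "\<And>c v. E (c *s v) = c * E v"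
    using U(2) by (auto simp: holomorphic_on_Cn_def)
  have "((\<lambda>r. f (inv_into U \<phi> (\<phi> r))) has_derivative (\<lambda>v. E (D v))) (at p)"
    by (rule has_derivative_compose[OF D(1) E(1)])
  then have "(f has_derivative (\<lambda>v. E (D v))) (at p)"
    by (rule has_derivative_transform_within_open[OF _ oU U(2)]) (use inj in simp)
  then show ?thesis using D(2) E(2) by auto
qed

lemma continuous_on_holomorphic_functions:
  assumes "complex_structure_determined_by J g10" "f \<in> holomorphic_functions (G_atlas J)"
  shows "continuous_on S f"
  using holomorphic_functions_has_derivative[OF assms] has_derivative_continuous
  by (meson continuous_at_imp_continuous_on)


section \<open>A section of the covering over a slit domain\<close>

definition slit_domain :: "(complex \<times> complex) set" where
  "slit_domain = {(z, q). Im z = 0 \<longrightarrow> Re q > 0}"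

text \<open>The point of \<open>G\<close> with \<open>x - e\<^sup>t = z - q\<close>, \<open>cnj x = z + q\<close> and \<open>y = 0\<close> for which \<open>t\<close> is the
  principal logarithm of \<open>e\<^sup>t = cnj (z + q) - (z - q)\<close>.\<close>

definition covering_section :: "complex \<Rightarrow> complex \<Rightarrow> G" where
  "covering_section z q = (Ln (q + cnj q + cnj z - z), cnj (z + q), 0)"

lemma slit_domain_imp_not_nonpos:
  "(z, q) \<in> slit_domain \<Longrightarrow> q + cnj q + cnj z - z \<notin> \<real>\<^sub>\<le>\<^sub>0"
  by (auto simp: slit_domain_def complex_nonpos_Reals_iff)

lemma continuous_on_covering_section:
  assumes "continuous_on S z" "continuous_on S q" "\<And>s. s \<in> S \<Longrightarrow> (z s, q s) \<in> slit_domain"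
  shows "continuous_on S (\<lambda>s. covering_section (z s) (q s))"
  unfolding covering_section_def
  using assms slit_domain_imp_not_nonpos by (intro continuous_intros continuous_on_Ln') auto

text \<open>The section is a holomorphic map since \<open>z - q\<close> and \<open>z + q\<close> are holomorphic coordinates.\<close>

lemma holomorphic_on_covering_section:
  assumes J: "complex_structure_determined_by J g10"
    and f: "f \<in> holomorphic_functions (G_atlas J)"
    and S: "open S" and hol: "z holomorphic_on S" "q holomorphic_on S"
    and slit: "\<And>s. s \<in> S \<Longrightarrow> (z s, q s) \<in> slit_domain"
  shows "(\<lambda>s. f (covering_section (z s) (q s))) holomorphic_on S"
  unfolding holomorphic_on_open[OF S]
proof
  fix s assume s: "s \<in> S"
  obtain z' q' where z': "(z has_derivative (*) z') (at s)" and q': "(q has_derivative (*) q') (at s)"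
    using hol s unfolding holomorphic_on_open[OF S] has_field_derivative_def by blast
  define w where "w = q s + cnj (q s) + cnj (z s) - z s"
  have w: "w \<notin> \<real>\<^sub>\<le>\<^sub>0" unfolding w_def by (intro slit_domain_imp_not_nonpos slit s)
  then have w0: "w \<noteq> 0" by auto
  define L where "L = (\<lambda>h. inverse w * (q' * h + cnj (q' * h) + cnj (z' * h) - z' * h))"
  have "((\<lambda>s. q s + cnj (q s) + cnj (z s) - z s) has_derivative
      (\<lambda>h. q' * h + cnj (q' * h) + cnj (z' * h) - z' * h)) (at s)"
    by (auto intro!: derivative_eq_intros z' q')
  from has_derivative_compose[OF this
      has_field_derivative_imp_has_derivative[OF has_field_derivative_Ln]] w
  have "((\<lambda>s. Ln (q s + cnj (q s) + cnj (z s) - z s)) has_derivative L) (at s)"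
    by (simp add: w_def L_def)
  moreover have "((\<lambda>s. cnj (z s + q s)) has_derivative (\<lambda>h. cnj (z' * h + q' * h))) (at s)"
    by (intro has_derivative_cnj has_derivative_add z' q')
  ultimately have c: "((\<lambda>s. covering_section (z s) (q s)) has_derivative
      (\<lambda>h. (L h, cnj (z' * h + q' * h), 0))) (at s)"
    unfolding covering_section_def by (intro has_derivative_Pair has_derivative_const)
  obtain D where D: "(f has_derivative D) (at (covering_section (z s) (q s)))"
    "\<And>v. D (left_invariant J (covering_section (z s) (q s)) v) = \<i> * D v"
    using holomorphic_functions_has_derivative[OF J f] by blast
  define E where "E = (\<lambda>h. D (L h, cnj (z' * h + q' * h), 0))"
  have E: "((\<lambda>s. f (covering_section (z s) (q s))) has_derivative E) (at s)"
    unfolding E_def by (rule has_derivative_compose[OF c D(1)])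
  have "left_invariant J (covering_section (z s) (q s)) (L h, cnj (z' * h + q' * h), 0) =
      (L (\<i> * h), cnj (z' * (\<i> * h) + q' * (\<i> * h)), 0)" for h
    using w0
    by (simp add: covering_section_def left_invariant_eq[OF J] exp_minus L_def flip: w_def)
       (simp add: field_simps)
  then have Ei: "E (\<i> * h) = \<i> * E h" for h
    unfolding E_def by (metis D(2))
  \<comment> \<open>a real-linear map commuting with \<open>\<i>\<close> is complex linear\<close>
  have "E h = E 1 * h" for h
  proof -
    have lin: "linear E" using E by (rule has_derivative_linear)
    have "E h = E (Re h *\<^sub>R 1 + Im h *\<^sub>R (\<i> * 1))"
      by (rule arg_cong[of _ _ E]) (simp add: complex_eq_iff)
    also have "\<dots> = Re h *\<^sub>R E 1 + Im h *\<^sub>R (\<i> * E 1)"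
      by (simp only: linear_add[OF lin] linear_scale[OF lin] Ei)
    also have "\<dots> = E 1 * h" by (simp add: complex_eq_iff)
    finally show ?thesis .
  qed
  then show "\<exists>f'. ((\<lambda>s. f (covering_section (z s) (q s))) has_field_derivative f') (at s)"
    using E by (metis has_field_derivative_def ext)
qed


section \<open>Failure of holomorphic separability\<close>

lemma vector_derivative_circlepath_continuous:
  "continuous_on S (\<lambda>t. vector_derivative (circlepath a r) (at t))"
  by (simp add: vector_derivative_circlepath) (intro continuous_intros)

text \<open>The boundary circle of an analytic disc stays off the slit even when the disc itself
  crosses it: its only real points are \<open>\<zeta> = 1\<close> and \<open>\<zeta> = -1\<close>, where \<open>\<zeta>\<^sup>2 + s = 1 + s\<close>.\<close>

lemma unit_circle_slit_domain:
  assumes "cmod \<zeta> = 1" "- 1 < Re s"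
  shows "(\<zeta>, \<zeta>\<^sup>2 + s) \<in> slit_domain"
  using assms by (auto simp: slit_domain_def power2_eq_square cmod_def)

text \<open>The continuity principle. For \<open>Re s > 0\<close> the whole disc lies in the slit domain and this is
  Cauchy's formula. Both sides remain holomorphic in \<open>s\<close> beyond that: the left one because the boundary
  circle still avoids the slit, the right one because its evaluation point is not real.\<close>

lemma holomorphic_functions_eq_disc_integral:
  assumes J: "complex_structure_determined_by J g10"
    and f: "f \<in> holomorphic_functions (G_atlas J)"
    and \<eta>: "\<eta> \<noteq> 0" "\<bar>\<eta>\<bar> < 1" and s: "\<bar>Re s\<bar> < 1"
  shows "contour_integral (circlepath 0 1)
      (\<lambda>\<zeta>. f (covering_section \<zeta> (\<zeta>\<^sup>2 + s)) / (\<zeta> - \<i> * of_real \<eta>)) =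
    2 * of_real pi * \<i> * f (covering_section (\<i> * of_real \<eta>) ((\<i> * of_real \<eta>)\<^sup>2 + s))"
    (is "?Q s = ?R s")
proof (rule analytic_continuation_open[where f = ?Q and g = ?R and z = s])
  let ?z = "\<i> * complex_of_real \<eta>"
  let ?A = "{s. \<bar>Re s\<bar> < 1}" and ?B = "{s. 0 < Re s \<and> Re s < 1}"
  note cont = continuous_on_holomorphic_functions[OF J f]
  show "open ?B" by (intro open_Collect_conj open_Collect_less continuous_intros)
  show A: "open ?A" by (intro open_Collect_less continuous_intros)
  have "1 / 2 \<in> ?B" by simp
  then show "?B \<noteq> {}" by blast
  have "?A = {s. - 1 < Re s} \<inter> {s. Re s < 1}" by auto
  then have "convex ?A"
    by (simp add: convex_Int convex_halfspace_Re_gt convex_halfspace_Re_lt)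
  then show "connected ?A" by (rule convex_connected)
  show "?B \<subseteq> ?A" by auto
  show "s \<in> ?A" using s by simp
  have z1: "cmod ?z < 1" using \<eta> by (simp add: norm_mult)
  show "?Q holomorphic_on ?A"
  proof (rule holomorphic_on_contour_integral_parameter[OF _ _ A _
          vector_derivative_circlepath_continuous])
    have "\<zeta> \<noteq> ?z" if "cmod \<zeta> = 1" for \<zeta> using z1 that by auto
    then show "continuous_on (path_image (circlepath 0 1) \<times> ?A)
        (\<lambda>(\<zeta>, s). f (covering_section \<zeta> (\<zeta>\<^sup>2 + s)) / (\<zeta> - ?z))"
      by (auto simp: case_prod_beta intro!: continuous_intros continuous_on_covering_section
          continuous_on_compose2[OF cont[of UNIV]] unit_circle_slit_domain)
    show "(\<lambda>s. f (covering_section \<zeta> (\<zeta>\<^sup>2 + s)) / (\<zeta> - ?z)) holomorphic_on ?A"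
      if "\<zeta> \<in> path_image (circlepath 0 1)" for \<zeta>
      using that z1
      by (auto intro!: holomorphic_intros holomorphic_on_covering_section[OF J f A]
          unit_circle_slit_domain)
  qed auto
  show "?R holomorphic_on ?A"
    using \<eta> by (intro holomorphic_intros holomorphic_on_covering_section[OF J f A])
      (auto simp: slit_domain_def)
  show "?Q s = ?R s" if "s \<in> ?B" for s
  proof -
    have "(\<lambda>\<zeta>. f (covering_section \<zeta> (\<zeta>\<^sup>2 + s))) holomorphic_on UNIV"
      using that
      by (intro holomorphic_on_covering_section[OF J f] holomorphic_intros)
         (auto simp: slit_domain_def power2_eq_square add_nonneg_pos)
    then have "(\<lambda>\<zeta>. f (covering_section \<zeta> (\<zeta>\<^sup>2 + s))) holomorphic_on cball 0 1"
      by (rule holomorphic_on_subset) simp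
    from Cauchy_integral_circlepath_simple[OF this] z1 show ?thesis
      by (intro contour_integral_unique) simp
  qed
qed

text \<open>The jump of the section across the slit, displayed as a summand: the remaining terms are
  continuous in \<open>\<eta>\<close> at \<open>0\<close>.\<close>

lemma covering_section_imaginary:
  fixes \<eta> :: real
  assumes "\<eta> \<noteq> 0"
  shows "covering_section (\<i> * of_real \<eta>) ((\<i> * of_real \<eta>)\<^sup>2 - 1 / 2) =
    (Ln (Complex (1 + 2 * \<eta>\<^sup>2) (2 * \<eta>)) - of_real (sgn \<eta>) * \<i> * of_real pi,
     Complex (- \<eta>\<^sup>2 - 1 / 2) (- \<eta>), 0)"
proof -
  have arg: "(\<i> * of_real \<eta>)\<^sup>2 - 1 / 2 + cnj ((\<i> * of_real \<eta>)\<^sup>2 - 1 / 2) + cnj (\<i> * of_real \<eta>)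
      - \<i> * of_real \<eta> = - Complex (1 + 2 * \<eta>\<^sup>2) (2 * \<eta>)"
    by (simp add: complex_eq_iff power2_eq_square)
  have pos: "0 < 1 + 2 * \<eta>\<^sup>2" by (simp add: add_pos_nonneg)
  have x: "cnj (\<i> * of_real \<eta> + ((\<i> * of_real \<eta>)\<^sup>2 - 1 / 2)) =
      Complex (- \<eta>\<^sup>2 - 1 / 2) (- \<eta>)"
    by (simp add: complex_eq_iff power2_eq_square)
  show ?thesis
    unfolding covering_section_def arg x
    using assms pos by (subst Ln_minus) (auto simp: complex_eq_iff sgn_if)
qed

text \<open>With \<open>s = -1/2\<close> in the continuity principle, the two one-sided limits as \<open>\<eta>\<close> tends to \<open>0\<close>
  are the values of \<open>f\<close> at two points in the same fibre of the covering, whereas the disc integral is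
  continuous at \<open>0\<close>.\<close>

lemma holomorphic_functions_same_value:
  assumes J: "complex_structure_determined_by J g10"
    and f: "f \<in> holomorphic_functions (G_atlas J)"
  shows "f (- \<i> * of_real pi, - 1 / 2, 0) = f (\<i> * of_real pi, - 1 / 2, 0)"
proof -
  define Q where "Q = (\<lambda>z. contour_integral (circlepath 0 1)
      (\<lambda>\<zeta>. f (covering_section \<zeta> (\<zeta>\<^sup>2 - 1 / 2)) / (\<zeta> - z)))"
  \<comment> \<open>the section along the imaginary axis, with the sign of \<open>\<eta>\<close> replaced by a constant \<open>c\<close>\<close>
  define P where "P = (\<lambda>c \<eta>. (Ln (Complex (1 + 2 * \<eta>\<^sup>2) (2 * \<eta>)) - of_real c * \<i> * of_real pi,
      Complex (- \<eta>\<^sup>2 - 1 / 2) (- \<eta>), 0 :: complex))"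
  note cont = continuous_on_holomorphic_functions[OF J f]
  have "continuous_on (path_image (circlepath 0 1) \<times> ball 0 1)
      (\<lambda>(\<zeta>, z). f (covering_section \<zeta> (\<zeta>\<^sup>2 - 1 / 2)) / (\<zeta> - z))"
    using unit_circle_slit_domain[of _ "- 1 / 2"]
    by (auto simp: case_prod_beta intro!: continuous_intros continuous_on_covering_section
          continuous_on_compose2[OF cont[of UNIV]])
  then have "continuous_on (ball 0 1) Q"
    unfolding Q_def
    by (rule continuous_on_contour_integral_parameter)
       (auto intro: vector_derivative_circlepath_continuous)
  then have Q: "isCont Q 0" by (simp add: continuous_on_eq_continuous_at)
  have Q_lim: "((\<lambda>\<eta>. Q (\<i> * of_real \<eta>)) \<longlongrightarrow> Q 0) (at 0)"
    by (rule isCont_tendsto_compose[OF Q]) (auto intro!: tendsto_eq_intros)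
  have P_lim: "((\<lambda>\<eta>. 2 * of_real pi * \<i> * f (P c \<eta>)) \<longlongrightarrow> 2 * of_real pi * \<i> * f (P c 0)) (at 0)"
    for c
  proof -
    have "continuous_on UNIV (P c)"
      unfolding P_def Complex_eq
      by (auto intro!: continuous_intros continuous_on_Ln'
          simp: complex_nonpos_Reals_iff not_le add_pos_nonneg)
    then have "continuous_on UNIV (\<lambda>\<eta>. 2 * of_real pi * \<i> * f (P c \<eta>))"
      by (intro continuous_intros continuous_on_compose2[OF cont[of UNIV]]) auto
    then show ?thesis
      by (simp add: continuous_on_eq_continuous_at isCont_def)
  qed
  have Q_eq: "Q (\<i> * of_real \<eta>) = 2 * of_real pi * \<i> * f (P (sgn \<eta>) \<eta>)"
    if "\<eta> \<noteq> 0" "\<bar>\<eta>\<bar> < 1" for \<eta>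
    using holomorphic_functions_eq_disc_integral[OF J f that, of "- 1 / 2"]
      covering_section_imaginary[OF that(1)]
    by (simp add: Q_def P_def)
  have "\<forall>\<^sub>F \<eta> in at_right 0. Q (\<i> * of_real \<eta>) = 2 * of_real pi * \<i> * f (P 1 \<eta>)"
    unfolding eventually_at_right_field by (intro exI[of _ 1]) (auto simp: Q_eq)
  with Q_lim have "((\<lambda>\<eta>. 2 * of_real pi * \<i> * f (P 1 \<eta>)) \<longlongrightarrow> Q 0) (at_right 0)"
    by (auto simp: filterlim_at_split intro: Lim_transform_eventually)
  then have "Q 0 = 2 * of_real pi * \<i> * f (P 1 0)"
    using P_lim[of 1] by (intro tendsto_unique) (auto simp: filterlim_at_split)
  moreover
  have "\<forall>\<^sub>F \<eta> in at_left 0. Q (\<i> * of_real \<eta>) = 2 * of_real pi * \<i> * f (P (- 1) \<eta>)"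
    unfolding eventually_at_left_field by (intro exI[of _ "- 1"]) (auto simp: Q_eq)
  with Q_lim have "((\<lambda>\<eta>. 2 * of_real pi * \<i> * f (P (- 1) \<eta>)) \<longlongrightarrow> Q 0) (at_left 0)"
    by (auto simp: filterlim_at_split intro: Lim_transform_eventually)
  then have "Q 0 = 2 * of_real pi * \<i> * f (P (- 1) 0)"
    using P_lim[of "- 1"] by (intro tendsto_unique) (auto simp: filterlim_at_split)
  moreover have "P c 0 = (- of_real c * \<i> * of_real pi, - 1 / 2, 0)" for c
    by (simp add: P_def Complex_eq)
  ultimately show ?thesis by simp
qed

theorem theorem1p2:
  fixes J :: "\<gg> \<Rightarrow> \<gg>"
  assumes "complex_structure_determined_by J g10"
  shows "\<not> stein (G_atlas J)"
proof
  assume "stein (G_atlas J)"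
  moreover have "(- \<i> * of_real pi, - 1 / 2, 0) \<noteq> (\<i> * of_real pi, - 1 / 2, 0 :: complex)"
    by (simp add: complex_eq_iff)
  ultimately show False
    using holomorphic_functions_same_value[OF assms]
    unfolding stein_def holomorphically_separable_def by metis
qed

end
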